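(* Let $\mathcal{G}_{12,\mathrm{conn}}$ be the set of all permutations $\pi$ (of any length $n\ge 0$) such that the occurrence graph $G_{12}(\pi)$ is connected. Then \[ \mathcal{G}_{12,\mathrm{conn}} = \mathrm{Av}(m), \] where $m=(3412,R)$ is the mesh pattern with underlying permutation $3412$ and shaded box set \[ R=\{(0,0),(0,1),(1,0),(1,1),(2,0),(2,1),(3,2),(3,3),(3,4),(4,2),(4,3),(4,4)\}. \] Moreover, the generating function $\sum_{n\ge0} |\mathcal{G}_{12,\mathrm{conn}}\cap\mathfrak{S}_n|\,x^n$ equals \[ \frac{F(x)-x}{(1-x)^2} + \frac{1}{1-x},\qquad\text{where } F(x) = 1 - \frac{1}{\sum_{k\ge0} k!\,x^k} \] is the generating function of skew-indecomposable permutations.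
   Context: $\mathfrak{S}_n$ is the set of permutations of $\{1,\dots,n\}$. For a permutation $\pi$ of length $n$, $V_{12}(\pi)$ is the set of pairs $\{i,j\}$ with $1\le i<j\le n$ and $\pi(i)<\pi(j)$, and the occurrence graph $G_{12}(\pi)$ is the simple undirected graph with vertex set $V_{12}(\pi)$ in which two vertices are adjacent iff they share exactly one element. A graph is connected if any two vertices are joined by a path; in particular graphs with no vertices (e.g. $G_{12}(\pi)$ for decreasing $\pi$) count as connected. A mesh pattern $(\tau,R)$ consists of $\tau\in\mathfrak{S}_k$ and $R\subseteq\{0,\dots,k\}^2$. A permutation $\pi$ of length $n$ contains $(\tau,R)$ if there are indices $i_1<\dots<i_k$ with $\pi(i_1)\cdots\pi(i_k)$ order-isomorphic to $\tau$ such that, setting $i_0=0$, $i_{k+1}=n+1$, letting $v_1<\dots<v_k$ be the values $\pi(i_1),\dots,\pi(i_k)$ in increasing order and $v_0=0$, $v_{k+1}=n+1$, for every $(a,b)\in R$ there is no index $x$ with $i_a<x<i_{a+1}$ and $v_b<\pi(x)<v_{b+1}$. Otherwise $\pi$ avoids $(\tau,R)$, and $\mathrm{Av}(m)$ is the set of permutations avoiding $m$. A permutation is skew-indecomposable if it cannot be written as a skew sum $\alpha\ominus\beta$ of two nonempty permutations, where $\alpha\ominus\beta$ for $\alpha\in\mathfrak{S}_a,\beta\in\mathfrak{S}_b$ is the permutation of length $a+b$ given by $\alpha(i)+b$ for $i\le a$ and $\beta(i-a)$ for $i>a$.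
   Formalization: In the clause that F is the generating function of skew-indecomposable permutations, the empty permutation is not counted: F has constant term 0, while the stated definition would make the empty permutation skew-indecomposable. *)

theory Defs
  imports
    "HOL-Combinatorics.Multiset_Permutations"
    "HOL-Computational_Algebra.Formal_Power_Series"
    "Graph_Theory.Graph_Theory"
begin

text \<open>
  Permutations are lists in one-line notation, so the length is part of the object and there is
  exactly one permutation of length 0. Positions are 1-based: \<open>ent \<pi> i\<close> is $\pi(i)$ and is only
  meaningful for \<open>i \<in> {1..length \<pi>}\<close>.
\<close>

definition perms_of_length :: "nat \<Rightarrow> nat list set" (\<open>\<SS>\<close>) where
  "\<SS> n = permutations_of_set {1..n}"

definition perms :: "nat list set" where
  "perms = (\<Union>n. \<SS> n)"

definition ent :: "nat list \<Rightarrow> nat \<Rightarrow> nat" where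
  "ent \<pi> i = \<pi> ! (i - 1)"

definition V12 :: "nat list \<Rightarrow> nat set set" where
  "V12 \<pi> = {{i, j} | i j. 1 \<le> i \<and> i < j \<and> j \<le> length \<pi> \<and> ent \<pi> i < ent \<pi> j}"

text \<open>
  A simple undirected graph is a symmetric loop-free digraph without parallel arcs
  (\<open>pair_graph\<close>); see \<open>pair_graph_G12\<close> below.
\<close>

definition G12 :: "nat list \<Rightarrow> nat set pair_pre_digraph" where
  "G12 \<pi> = \<lparr> pverts = V12 \<pi>,
             parcs = {(u, v). u \<in> V12 \<pi> \<and> v \<in> V12 \<pi> \<and> card (u \<inter> v) = 1} \<rparr>"

text \<open>
  The library predicate \<open>connected\<close> is false for the graph without vertices, which here counts as
  connected; \<open>joined_iff\<close> shows that this is the only difference.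
\<close>

definition joined :: "('a, 'b) pre_digraph \<Rightarrow> bool" where
  "joined G \<longleftrightarrow> (\<forall>u \<in> verts G. \<forall>v \<in> verts G. u \<rightarrow>\<^sup>*\<^bsub>G\<^esub> v)"

definition G12_conn :: "nat list set" where
  "G12_conn = {\<pi> \<in> perms. joined (with_proj (G12 \<pi>))}"

type_synonym mesh_pattern = "nat list \<times> (nat \<times> nat) set"

definition is_mesh_pattern :: "mesh_pattern \<Rightarrow> bool" where
  "is_mesh_pattern = (\<lambda>(\<tau>, R). \<tau> \<in> perms \<and> R \<subseteq> {0..length \<tau>} \<times> {0..length \<tau>})"

text \<open>
  In the following definition \<open>\<iota> a\<close> is $i_a$ and \<open>v b\<close> is $v_b$, for $0 \le a, b \le k + 1$.
  Strict monotonicity together with the boundary values forces \<open>\<iota> a, v b \<in> {1..n}\<close> for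
  \<open>a, b \<in> {1..k}\<close>, and determines \<open>v\<close> on \<open>{0..k+1}\<close> from \<open>\<iota>\<close>.
\<close>

definition mesh_contains :: "nat list \<Rightarrow> mesh_pattern \<Rightarrow> bool" where
  "mesh_contains \<pi> = (\<lambda>(\<tau>, R). let n = length \<pi>; k = length \<tau> in
     \<exists>\<iota> v :: nat \<Rightarrow> nat.
       strict_mono_on {0..k+1} \<iota> \<and> \<iota> 0 = 0 \<and> \<iota> (k+1) = n+1 \<and>
       (\<forall>a \<in> {1..k}. \<forall>b \<in> {1..k}. ent \<pi> (\<iota> a) < ent \<pi> (\<iota> b) \<longleftrightarrow> ent \<tau> a < ent \<tau> b) \<and>
       strict_mono_on {0..k+1} v \<and> v 0 = 0 \<and> v (k+1) = n+1 \<and>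
       v ` {1..k} = (\<lambda>a. ent \<pi> (\<iota> a)) ` {1..k} \<and>
       (\<forall>(a, b) \<in> R. \<not> (\<exists>x \<in> {1..n}. \<iota> a < x \<and> x < \<iota> (a+1) \<and>
                                      v b < ent \<pi> x \<and> ent \<pi> x < v (b+1))))"

definition Av :: "mesh_pattern \<Rightarrow> nat list set" where
  "Av m = {\<pi> \<in> perms. \<not> mesh_contains \<pi> m}"

definition mesh_3412 :: mesh_pattern where
  "mesh_3412 = ([3, 4, 1, 2],
     {(0,0), (0,1), (1,0), (1,1), (2,0), (2,1), (3,2), (3,3), (3,4), (4,2), (4,3), (4,4)})"

definition skew_sum :: "nat list \<Rightarrow> nat list \<Rightarrow> nat list" (infixr \<open>\<ominus>\<^sub>s\<close> 65) where
  "\<alpha> \<ominus>\<^sub>s \<beta> = map (\<lambda>x. x + length \<beta>) \<alpha> @ \<beta>"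

definition skew_indecomposable :: "nat list \<Rightarrow> bool" where
  "skew_indecomposable \<pi> \<longleftrightarrow>
     \<not> (\<exists>\<alpha> \<in> perms. \<exists>\<beta> \<in> perms. \<alpha> \<noteq> [] \<and> \<beta> \<noteq> [] \<and> \<pi> = \<alpha> \<ominus>\<^sub>s \<beta>)"

definition gen_fun :: "nat list set \<Rightarrow> rat fps" where
  "gen_fun A = Abs_fps (\<lambda>n. of_nat (card (A \<inter> \<SS> n)))"


lemma pair_graph_G12: "pair_graph (G12 \<pi>)"
proof -
  have fin: "finite (V12 \<pi>)"
    by (rule finite_subset[of _ "Pow {1..length \<pi>}"]) (auto simp: V12_def)
  have two: "card u = 2" if "u \<in> V12 \<pi>" for u
    using that by (auto simp: V12_def)
  have "parcs (G12 \<pi>) \<subseteq> V12 \<pi> \<times> V12 \<pi>"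
    by (auto simp: G12_def)
  then have "finite (parcs (G12 \<pi>))"
    using fin by (meson finite_SigmaI finite_subset)
  then show ?thesis
    using fin two
    by unfold_locales
      (auto simp: G12_def symmetric_def sym_def Int_commute)
qed

lemma joined_iff:
  assumes "graph G"
  shows "joined G \<longleftrightarrow> verts G = {} \<or> connected G"
proof -
  interpret graph G by fact
  show ?thesis
    by (auto simp: joined_def connected_def strongly_connected_def
        reachable_mk_symmetric_eq[OF sym_arcs])
qed

lemma is_mesh_pattern_mesh_3412: "is_mesh_pattern mesh_3412"
proof -
  have "[3, 4, 1, 2] \<in> \<SS> 4"
    by (auto simp: perms_of_length_def permutations_of_set_def)
  then show ?thesis
    by (auto simp: is_mesh_pattern_def mesh_3412_def perms_def)
qed

end

theory Submission
  imports Defs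
begin

text \<open>
  Every nonempty permutation is uniquely a skew sum $\alpha \ominus \beta$ with $\alpha$ skew-indecomposable
  and nonempty, and the occurrence graph of $\alpha \ominus \beta$ is the disjoint union of those of
  $\alpha$ and $\beta$. A skew-indecomposable permutation has a connected occurrence graph, so a
  permutation has a connected occurrence graph iff at most one of its skew components has length
  greater than 1. Writing $P$, $D$, $C$ for the generating functions of all permutations, the
  decreasing ones and the connected ones, removing the first component gives $P = 1 + F P$,
  $D = 1 + x D$ and $C = 1 + x C + (F - x) D$.

  The shading of the mesh pattern forces everything left of the entry 1 of an occurrence to lie
  above the entry 2, and everything to its right not to exceed the entry 2. An occurrence is
  therefore a decomposition $\alpha \ominus \beta$ with an ascent pair in $\alpha$, where 1 and 2 are
  played by the first and the largest entry of $\beta$.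
\<close>

section \<open>Skew sums of permutations\<close>

lemma perms_iff: "\<pi> \<in> perms \<longleftrightarrow> distinct \<pi> \<and> set \<pi> = {1..length \<pi>}"
proof
  assume "\<pi> \<in> perms"
  then obtain n where n: "set \<pi> = {1..n}" "distinct \<pi>"
    by (auto simp: perms_def perms_of_length_def permutations_of_set_def)
  then have "length \<pi> = n"
    using distinct_card by fastforce
  with n show "distinct \<pi> \<and> set \<pi> = {1..length \<pi>}" by simp
qed (auto simp: perms_def perms_of_length_def permutations_of_set_def)

lemma perms_of_length_iff: "\<pi> \<in> \<SS> n \<longleftrightarrow> \<pi> \<in> perms \<and> length \<pi> = n"
proof
  assume *: "\<pi> \<in> \<SS> n"
  then have "\<pi> \<in> perms" by (auto simp: perms_def)
  moreover have "length \<pi> = n"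
    using * distinct_card[of \<pi>] by (auto simp: perms_of_length_def permutations_of_set_def)
  ultimately show "\<pi> \<in> perms \<and> length \<pi> = n" by simp
qed (auto simp: perms_iff perms_of_length_def permutations_of_set_def)

lemma Nil_in_perms [simp]: "[] \<in> perms"
  by (simp add: perms_iff)

lemma singleton_in_perms [simp]: "[Suc 0] \<in> perms"
  by (simp add: perms_iff)

lemma length_1_perm:
  assumes "\<pi> \<in> perms" "length \<pi> = 1"
  shows "\<pi> = [1]"
proof -
  obtain x where x: "\<pi> = [x]" using assms(2) by (auto simp: length_Suc_conv)
  have "set \<pi> = {1..length \<pi>}" using assms(1) unfolding perms_iff by blast
  then show ?thesis by (simp add: x)
qed

lemma ent_in_set: "1 \<le> i \<Longrightarrow> i \<le> length \<pi> \<Longrightarrow> ent \<pi> i \<in> set \<pi>"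
  by (simp add: ent_def)

lemma ent_bounds:
  assumes "\<pi> \<in> perms" "1 \<le> i" "i \<le> length \<pi>"
  shows "1 \<le> ent \<pi> i" "ent \<pi> i \<le> length \<pi>"
  using ent_in_set[OF assms(2,3)] assms(1) by (auto simp: perms_iff)

lemma ent_eq_iff:
  assumes "\<pi> \<in> perms" "1 \<le> i" "i \<le> length \<pi>" "1 \<le> j" "j \<le> length \<pi>"
  shows "ent \<pi> i = ent \<pi> j \<longleftrightarrow> i = j"
proof -
  have "ent \<pi> i = ent \<pi> j \<longleftrightarrow> i - 1 = j - 1"
    unfolding ent_def using assms by (subst nth_eq_iff_index_eq) (auto simp: perms_iff)
  then show ?thesis using assms by auto
qed

lemma length_skew_sum [simp]: "length (\<alpha> \<ominus>\<^sub>s \<beta>) = length \<alpha> + length \<beta>"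
  by (simp add: skew_sum_def)

lemma skew_sum_Nil [simp]: "\<alpha> \<ominus>\<^sub>s [] = \<alpha>" "[] \<ominus>\<^sub>s \<beta> = \<beta>"
  by (simp_all add: skew_sum_def)

lemma skew_sum_eq_Nil_iff [simp]: "\<alpha> \<ominus>\<^sub>s \<beta> = [] \<longleftrightarrow> \<alpha> = [] \<and> \<beta> = []"
  by (simp add: skew_sum_def)

lemma skew_sum_assoc: "(\<alpha> \<ominus>\<^sub>s \<beta>) \<ominus>\<^sub>s \<gamma> = \<alpha> \<ominus>\<^sub>s \<beta> \<ominus>\<^sub>s \<gamma>"
  by (simp add: skew_sum_def)

lemma shift_atLeastAtMost: "(\<lambda>x. x + b) ` {1..a::nat} = {b + 1..b + a}"
  by (simp add: add.commute)

lemma skew_sum_in_perms: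
  assumes "\<alpha> \<in> perms" "\<beta> \<in> perms"
  shows "\<alpha> \<ominus>\<^sub>s \<beta> \<in> perms"
  using assms shift_atLeastAtMost[of "length \<beta>" "length \<alpha>"]
  by (auto simp: perms_iff skew_sum_def distinct_map)

text \<open>The shifted entries of \<open>\<alpha>\<close> take up exactly the top
  \<open>length \<alpha>\<close> values, so an initial segment is left for
  \<open>\<gamma>\<close>.\<close>

lemma skew_sum_right_in_perms:
  assumes "\<alpha> \<in> perms" "\<alpha> \<ominus>\<^sub>s \<gamma> \<in> perms"
  shows "\<gamma> \<in> perms"
proof -
  let ?c = "length \<gamma>" and ?a = "length \<alpha>"
  have "(\<lambda>x. x + ?c) ` set \<alpha> = {?c + 1..?c + ?a}"
    using assms(1) shift_atLeastAtMost by (simp add: perms_iff)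
  moreover have "(\<lambda>x. x + ?c) ` set \<alpha> \<union> set \<gamma> = {1..?a + ?c}"
    "(\<lambda>x. x + ?c) ` set \<alpha> \<inter> set \<gamma> = {}" "distinct \<gamma>"
    using assms(2) by (simp_all add: perms_iff skew_sum_def)
  ultimately have "set \<gamma> = {1..?a + ?c} - {?c + 1..?c + ?a}" "distinct \<gamma>"
    by auto
  moreover have "{1..?a + ?c} - {?c + 1..?c + ?a} = {1..?c}" by auto
  ultimately show ?thesis unfolding perms_iff by metis
qed

lemma ent_skew_sum_left: "1 \<le> i \<Longrightarrow> i \<le> length \<alpha> \<Longrightarrow> ent (\<alpha> \<ominus>\<^sub>s \<beta>) i = ent \<alpha> i + length \<beta>"
  by (auto simp: ent_def skew_sum_def nth_append)

lemma ent_skew_sum_right: "1 \<le> j \<Longrightarrow> ent (\<alpha> \<ominus>\<^sub>s \<beta>) (length \<alpha> + j) = ent \<beta> j"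
  by (auto simp: ent_def skew_sum_def nth_append)

text \<open>The values to the right of the cut form a down-closed subset of {1..n}, hence an initial
  segment. The values to the left are the remaining ones, and lowering them gives
  \<open>\<alpha>\<close>.\<close>

lemma skew_sum_cut:
  assumes \<pi>: "\<pi> \<in> perms" and s: "s \<le> length \<pi>"
    and cut: "\<And>i j. 1 \<le> i \<Longrightarrow> i \<le> s \<Longrightarrow> s < j \<Longrightarrow> j \<le> length \<pi> \<Longrightarrow> ent \<pi> j < ent \<pi> i"
  obtains \<alpha> \<beta> where "\<alpha> \<in> perms" "\<beta> \<in> perms" "length \<alpha> = s" "\<pi> = \<alpha> \<ominus>\<^sub>s \<beta>"
proof -
  define n where "n = length \<pi>"
  define A where "A = take s \<pi>"
  define B where "B = drop s \<pi>"
  have AB: "\<pi> = A @ B" "length A = s" "length B = n - s"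
    using s by (simp_all add: A_def B_def n_def)
  have lt: "y < x" if xy: "x \<in> set A" "y \<in> set B" for x y
  proof -
    from xy obtain i j where i: "i < s" "x = A ! i" and j: "j < n - s" "y = B ! j"
      by (metis AB(2,3) in_set_conv_nth)
    show ?thesis
      using cut[of "Suc i" "s + j + 1"] i j s AB(2)
      by (simp add: ent_def AB(1) nth_append n_def)
  qed
  have dist: "distinct A" "distinct B" "set A \<inter> set B = {}" and un: "set A \<union> set B = {1..n}"
    using \<pi> unfolding perms_iff n_def by (auto simp: AB(1))
  have cardB: "card (set B) = n - s"
    using distinct_card[OF dist(2)] AB by simp
  have "set B \<subseteq> {1..n - s}"
  proof
    fix y assume y: "y \<in> set B"
    \<comment> \<open>A value z \<le> y cannot stand left of the cut, where everything exceeds y.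
      Consequently y is at most the cardinality of \<open>set B\<close>.\<close>
    have "{1..y} \<subseteq> set B"
    proof
      fix z assume z: "z \<in> {1..y}"
      have "y \<le> n" using y un by auto
      with z un have "z \<in> set A \<union> set B" by auto
      then show "z \<in> set B" using lt[of z y] y z by auto
    qed
    then have "card {1..y} \<le> card (set B)" by (intro card_mono) auto
    then show "y \<in> {1..n - s}" using cardB y un by auto
  qed
  then have setB: "set B = {1..n - s}"
    by (intro card_subset_eq) (simp_all add: cardB)
  then have setA: "set A = {n - s + 1..n}"
  proof -
    have "set A = {1..n} - {1..n - s}"
      using un dist(3) setB by blast
    also have "\<dots> = {n - s + 1..n}" by auto
    finally show ?thesis .
  qed
  define \<alpha> where "\<alpha> = map (\<lambda>x. x - (n - s)) A"
  have "map (\<lambda>x. x + (n - s)) \<alpha> = A"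
    unfolding \<alpha>_def by (simp add: comp_def) (rule map_idI, simp add: setA)
  then have eq: "\<pi> = \<alpha> \<ominus>\<^sub>s B"
    by (simp add: skew_sum_def AB)
  \<comment> \<open>Truncated subtraction is injective here because all entries of \<open>A\<close>
    exceed \<open>n - s\<close>.\<close>
  have "inj_on (\<lambda>x. x - (n - s)) (set A)"
    by (rule inj_onI) (auto simp: setA)
  moreover have "(\<lambda>x. x - (n - s)) ` {n - s + 1..n} = {1..s}"
  proof (intro equalityI subsetI)
    fix x assume x: "x \<in> {1..s}"
    show "x \<in> (\<lambda>x. x - (n - s)) ` {n - s + 1..n}"
      by (rule image_eqI[of _ _ "x + (n - s)"]) (use x s in \<open>auto simp: n_def\<close>)
  qed (use s in \<open>auto simp: n_def\<close>)
  ultimately have "\<alpha> \<in> perms"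
    by (simp add: perms_iff \<alpha>_def distinct_map dist setA AB)
  moreover have "B \<in> perms"
    by (simp add: perms_iff dist setB AB)
  moreover have "length \<alpha> = s" by (simp add: \<alpha>_def AB)
  ultimately show ?thesis using eq that by blast
qed

text \<open>The empty list satisfies \<open>skew_indecomposable\<close>. Leaving it out makes the
  first component unique and gives F constant term 0.\<close>

definition skew_prime :: "nat list set" where
  "skew_prime = {\<pi> \<in> perms. \<pi> \<noteq> [] \<and> skew_indecomposable \<pi>}"

lemma singleton_skew_prime [simp]: "[Suc 0] \<in> skew_prime"
proof -
  have False if "\<alpha> \<noteq> []" "\<beta> \<noteq> []" "[Suc 0] = \<alpha> \<ominus>\<^sub>s \<beta>" for \<alpha> \<beta>
    using that(1,2) arg_cong[OF that(3), of length] by (cases \<alpha>; cases \<beta>) auto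
  then show ?thesis by (auto simp: skew_prime_def skew_indecomposable_def)
qed

text \<open>If \<open>\<alpha>\<close> were shorter than \<open>\<alpha>'\<close>, comparing
  prefixes would exhibit it as a proper left skew factor of \<open>\<alpha>'\<close>, contradicting
  indecomposability.\<close>

lemma skew_sum_left_unique_le:
  assumes "\<alpha> \<in> perms" "\<alpha> \<noteq> []" "\<alpha>' \<in> skew_prime"
    and "\<alpha> \<ominus>\<^sub>s \<beta> = \<alpha>' \<ominus>\<^sub>s \<beta>'"
  shows "length \<alpha>' \<le> length \<alpha>"
proof (rule ccontr)
  assume less: "\<not> ?thesis"
  define \<gamma> where "\<gamma> = drop (length \<alpha>) \<alpha>'"
  have len: "length \<alpha> + length \<beta> = length \<alpha>' + length \<beta>'"
    using arg_cong[OF assms(4), of length] by simp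
  have "map (\<lambda>x. x + length \<beta>') (take (length \<alpha>) \<alpha>') = map (\<lambda>x. x + length \<beta>) \<alpha>"
    using arg_cong[OF assms(4), of "take (length \<alpha>)"] less by (simp add: skew_sum_def take_map)
  \<comment> \<open>The total lengths agree, so the shift by \<open>length \<beta>\<close> splits
    into \<open>length \<gamma>\<close> plus \<open>length \<beta>'\<close>.\<close>
  also have "\<dots> = map (\<lambda>x. x + length \<beta>') (map (\<lambda>x. x + length \<gamma>) \<alpha>)"
    using len less by (auto simp: \<gamma>_def)
  finally have "take (length \<alpha>) \<alpha>' = map (\<lambda>x. x + length \<gamma>) \<alpha>"
    by (subst (asm) inj_map_eq_map) (auto simp: inj_def)
  then have eq: "\<alpha>' = \<alpha> \<ominus>\<^sub>s \<gamma>"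
    by (metis \<gamma>_def append_take_drop_id skew_sum_def)
  moreover have "\<gamma> \<in> perms"
    using skew_sum_right_in_perms[of \<alpha> \<gamma>] assms(1,3) eq by (simp add: skew_prime_def)
  moreover have "\<gamma> \<noteq> []" using less by (simp add: \<gamma>_def)
  ultimately show False
    using assms(1-3) by (auto simp: skew_prime_def skew_indecomposable_def)
qed

text \<open>The previous lemma, used in both directions, fixes the length of the first component.
  Both lists are then cut at the same place and shifted by the same amount.\<close>

lemma inj_on_skew_sum: "inj_on (\<lambda>(\<alpha>, \<beta>). \<alpha> \<ominus>\<^sub>s \<beta>) (skew_prime \<times> perms)"
proof (rule inj_onI, clarify)
  fix \<alpha> \<beta> \<alpha>' \<beta>'
  assume *: "\<alpha> \<in> skew_prime" "\<alpha>' \<in> skew_prime" and eq: "\<alpha> \<ominus>\<^sub>s \<beta> = \<alpha>' \<ominus>\<^sub>s \<beta>'"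
  have "length \<alpha> = length \<alpha>'"
    using skew_sum_left_unique_le[of \<alpha> \<alpha>' \<beta> \<beta>'] skew_sum_left_unique_le[of \<alpha>' \<alpha> \<beta>' \<beta>] * eq
    by (auto simp: skew_prime_def)
  moreover from this have "length \<beta> = length \<beta>'"
    using arg_cong[OF eq, of length] by simp
  ultimately show "\<alpha> = \<alpha>' \<and> \<beta> = \<beta>'"
    using eq by (auto simp: skew_sum_def inj_map_eq_map inj_def)
qed

text \<open>An indecomposable permutation is its own first component, with empty rest. Otherwise the
  first component of the left factor serves, after reassociating.\<close>

lemma first_component_exists:
  assumes "\<pi> \<in> perms" "\<pi> \<noteq> []"
  obtains \<alpha> \<beta> where "\<alpha> \<in> skew_prime" "\<beta> \<in> perms" "\<pi> = \<alpha> \<ominus>\<^sub>s \<beta>"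
  using assms
proof (induction "length \<pi>" arbitrary: \<pi> thesis rule: less_induct)
  case less
  show ?case
  proof (cases "skew_indecomposable \<pi>")
    case True
    then show ?thesis
      using less.prems(1)[of \<pi> "[]"] less.prems(2,3) by (simp add: skew_prime_def)
  next
    case False
    then obtain \<alpha> \<beta> where *: "\<alpha> \<in> perms" "\<beta> \<in> perms" "\<alpha> \<noteq> []" "\<beta> \<noteq> []" "\<pi> = \<alpha> \<ominus>\<^sub>s \<beta>"
      by (auto simp: skew_indecomposable_def)
    then have "length \<alpha> < length \<pi>" by simp
    then obtain \<alpha>' \<beta>' where "\<alpha>' \<in> skew_prime" "\<beta>' \<in> perms" "\<alpha> = \<alpha>' \<ominus>\<^sub>s \<beta>'"
      using less.hyps * by blast
    then show ?thesis
      using less.prems(1)[of \<alpha>' "\<beta>' \<ominus>\<^sub>s \<beta>"] * by (simp add: skew_sum_assoc skew_sum_in_perms)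
  qed
qed

section \<open>Connectedness of occurrence graphs\<close>

text \<open>The edge relation of the occurrence graph, taken over arbitrary families of sets so that
  the unions and shifted copies produced by skew sums are covered too.\<close>

definition share :: "'a set set \<Rightarrow> ('a set \<times> 'a set) set" where
  "share V = {(u, v). u \<in> V \<and> v \<in> V \<and> card (u \<inter> v) = 1}"

definition linked :: "'a set set \<Rightarrow> bool" where
  "linked V \<longleftrightarrow> (\<forall>u \<in> V. \<forall>v \<in> V. (u, v) \<in> (share V)\<^sup>*)"

text \<open>Reachability in \<open>pre_digraph\<close> is \<open>rtrancl_on\<close> the vertex set.
  As all edges stay inside it, a start in that set suffices to pass to the ordinary closure.\<close>

lemma rtrancl_on_eq_rtrancl:
  assumes "r \<subseteq> F \<times> F" "a \<in> F"
  shows "(a, b) \<in> rtrancl_on F r \<longleftrightarrow> (a, b) \<in> r\<^sup>*"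
proof
  assume "(a, b) \<in> rtrancl_on F r"
  then show "(a, b) \<in> r\<^sup>*"
    by (induction rule: rtrancl_on_induct) (auto intro: rtrancl_into_rtrancl)
next
  assume "(a, b) \<in> r\<^sup>*"
  then show "(a, b) \<in> rtrancl_on F r"
    by (induction rule: rtrancl_induct)
      (use assms in \<open>auto intro: rtrancl_on_into_rtrancl_on\<close>)
qed

lemma joined_G12_iff: "joined (with_proj (G12 \<pi>)) \<longleftrightarrow> linked (V12 \<pi>)"
proof -
  have "arcs_ends (with_proj (G12 \<pi>)) = share (V12 \<pi>)"
    by (auto simp: arcs_ends_def arc_to_ends_def G12_def share_def)
  moreover have "verts (with_proj (G12 \<pi>)) = V12 \<pi>"
    by (simp add: G12_def)
  moreover have "share (V12 \<pi>) \<subseteq> V12 \<pi> \<times> V12 \<pi>"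
    by (auto simp: share_def)
  ultimately show ?thesis
    by (auto simp: joined_def linked_def reachable_def rtrancl_on_eq_rtrancl)
qed

lemma G12_conn_eq: "G12_conn = {\<pi> \<in> perms. linked (V12 \<pi>)}"
  by (simp add: G12_conn_def joined_G12_iff)

text \<open>An injection on the ground set commutes with intersection and keeps cardinalities, so it
  carries edges to edges. The intended use is shifting positions.\<close>

lemma linked_image:
  assumes "inj_on f (\<Union>V)" "linked V"
  shows "linked ((`) f ` V)"
proof -
  have step: "(f ` u, f ` v) \<in> share ((`) f ` V)" if "(u, v) \<in> share V" for u v
  proof -
    have uv: "u \<in> V" "v \<in> V" "card (u \<inter> v) = 1" using that by (auto simp: share_def)
    then have "f ` u \<inter> f ` v = f ` (u \<inter> v)"
      using assms(1) by (intro inj_on_image_Int[symmetric]) auto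
    moreover have "card (f ` (u \<inter> v)) = card (u \<inter> v)"
      by (rule card_image, rule inj_on_subset[OF assms(1)]) (use uv in auto)
    ultimately show ?thesis using uv by (simp add: share_def)
  qed
  have "(f ` u, f ` v) \<in> (share ((`) f ` V))\<^sup>*" if "(u, v) \<in> (share V)\<^sup>*" for u v
    using that by induction (auto intro: rtrancl_into_rtrancl step)
  then show ?thesis using assms(2) by (auto simp: linked_def)
qed

lemma linked_image_iff:
  assumes "inj f"
  shows "linked ((`) f ` V) \<longleftrightarrow> linked V"
proof
  assume "linked ((`) f ` V)"
  then have "linked ((`) (inv f) ` (`) f ` V)"
    by (rule linked_image[rotated]) (rule inj_on_inv_into, auto)
  moreover have "(`) (inv f) ` (`) f ` V = V"
    using assms by (simp add: image_image image_inv_f_f)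
  ultimately show "linked V" by simp
qed (rule linked_image, rule inj_on_subset[OF assms], auto)

section \<open>Occurrences in a skew sum\<close>

lemma V12_iff:
  "u \<in> V12 \<pi> \<longleftrightarrow> (\<exists>i j. u = {i, j} \<and> 1 \<le> i \<and> i < j \<and> j \<le> length \<pi> \<and> ent \<pi> i < ent \<pi> j)"
  by (simp add: V12_def)

lemma V12I:
  "1 \<le> i \<Longrightarrow> i < j \<Longrightarrow> j \<le> length \<pi> \<Longrightarrow> ent \<pi> i < ent \<pi> j \<Longrightarrow> {i, j} \<in> V12 \<pi>"
  unfolding V12_iff by blast

text \<open>No ascent straddles the two factors: entries from \<open>\<alpha>\<close> exceed
  \<open>length \<beta>\<close>, entries from \<open>\<beta>\<close> do not.\<close>

lemma V12_skew_sum: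
  assumes "\<alpha> \<in> perms" "\<beta> \<in> perms"
  shows "V12 (\<alpha> \<ominus>\<^sub>s \<beta>) = V12 \<alpha> \<union> (`) ((+) (length \<alpha>)) ` V12 \<beta>"
proof (intro equalityI subsetI)
  fix u assume "u \<in> V12 (\<alpha> \<ominus>\<^sub>s \<beta>)"
  then obtain i j where u: "u = {i, j}" and ij: "1 \<le> i" "i < j" "j \<le> length \<alpha> + length \<beta>"
    and lt: "ent (\<alpha> \<ominus>\<^sub>s \<beta>) i < ent (\<alpha> \<ominus>\<^sub>s \<beta>) j"
    unfolding V12_iff by auto
  consider "j \<le> length \<alpha>" | "i \<le> length \<alpha>" "length \<alpha> < j" | "length \<alpha> < i" by linarith
  then show "u \<in> V12 \<alpha> \<union> (`) ((+) (length \<alpha>)) ` V12 \<beta>"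
  proof cases
    case 1
    then have "u \<in> V12 \<alpha>"
      unfolding u using ij lt by (intro V12I) (simp_all add: ent_skew_sum_left)
    then show ?thesis ..
  next
    case 2
    then obtain j' where j': "j = length \<alpha> + j'" "1 \<le> j'"
      by (metis less_imp_add_positive Suc_leI One_nat_def)
    have "ent \<beta> j' \<le> length \<beta>" using ent_bounds[OF assms(2)] j' ij by auto
    moreover have "ent \<alpha> i \<ge> 1" using ent_bounds[OF assms(1)] 2 ij by auto
    ultimately show ?thesis
      using lt 2 j' ij by (simp add: ent_skew_sum_left ent_skew_sum_right)
  next
    case 3
    then obtain i' where i': "i = length \<alpha> + i'" "1 \<le> i'"
      by (metis less_imp_add_positive Suc_leI One_nat_def)
    obtain j' where j': "j = length \<alpha> + j'" "1 \<le> j'"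
      using 3 ij by (metis less_imp_add_positive less_trans Suc_leI One_nat_def)
    have "{i', j'} \<in> V12 \<beta>"
      using i' j' ij lt by (intro V12I) (simp_all add: ent_skew_sum_right)
    moreover have "u = (+) (length \<alpha>) ` {i', j'}" using u i' j' by simp
    ultimately show ?thesis by blast
  qed
next
  fix u assume "u \<in> V12 \<alpha> \<union> (`) ((+) (length \<alpha>)) ` V12 \<beta>"
  then show "u \<in> V12 (\<alpha> \<ominus>\<^sub>s \<beta>)"
  proof
    assume "u \<in> V12 \<alpha>"
    then obtain i j where "u = {i, j}" "1 \<le> i" "i < j" "j \<le> length \<alpha>" "ent \<alpha> i < ent \<alpha> j"
      by (auto simp: V12_iff)
    then show ?thesis
      by (auto intro!: V12I simp: ent_skew_sum_left)
  next
    assume "u \<in> (`) ((+) (length \<alpha>)) ` V12 \<beta>"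
    then obtain i j where "u = {length \<alpha> + i, length \<alpha> + j}"
      "1 \<le> i" "i < j" "j \<le> length \<beta>" "ent \<beta> i < ent \<beta> j"
      by (auto simp: V12_iff)
    then show ?thesis
      by (auto intro!: V12I simp: ent_skew_sum_right)
  qed
qed

lemma V12_Nil [simp]: "V12 [] = {}"
  by (auto simp: V12_iff)

lemma V12_singleton [simp]: "V12 [x] = {}"
  by (auto simp: V12_iff)

lemma linked_empty [simp]: "linked {}"
  by (simp add: linked_def)

text \<open>No edge leaves \<open>A\<close>, so no path does. Since \<open>B\<close> lacks the empty
  set, the two families have no common member: such a member would be disjoint from itself.\<close>

lemma not_linked_Un:
  assumes "A \<noteq> {}" "B \<noteq> {}" "\<And>u v. u \<in> A \<Longrightarrow> v \<in> B \<Longrightarrow> u \<inter> v = {}" "{} \<notin> B"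
  shows "\<not> linked (A \<union> B)"
proof
  assume linked: "linked (A \<union> B)"
  obtain a b where ab: "a \<in> A" "b \<in> B" using assms by blast
  have "v \<in> A" if "(a, v) \<in> (share (A \<union> B))\<^sup>*" for v
    using that
  proof induction
    case (step v w)
    then show ?case using assms(3)[of v w] by (auto simp: share_def)
  qed (fact ab)
  then have "b \<in> A" using linked ab by (auto simp: linked_def)
  then show False using assms(3)[of b b] assms(4) ab by auto
qed

lemma linked_skew_sum_iff:
  assumes "\<alpha> \<in> perms" "\<beta> \<in> perms"
  shows "linked (V12 (\<alpha> \<ominus>\<^sub>s \<beta>)) \<longleftrightarrow>
    V12 \<alpha> = {} \<and> linked (V12 \<beta>) \<or> V12 \<beta> = {} \<and> linked (V12 \<alpha>)"
proof (cases "V12 \<alpha> = {} \<or> V12 \<beta> = {}")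
  case True
  then show ?thesis
    using V12_skew_sum[OF assms] linked_image_iff[of "(+) (length \<alpha>)" "V12 \<beta>"] by auto
next
  case False
  have "\<not> linked (V12 \<alpha> \<union> (`) ((+) (length \<alpha>)) ` V12 \<beta>)"
    by (rule not_linked_Un) (use False in \<open>auto simp: V12_iff\<close>)
  then show ?thesis using V12_skew_sum[OF assms] False by simp
qed

text \<open>The number s names the gap between positions s and s + 1. A permutation splits as a skew
  sum precisely at the inner gaps that no ascent crosses.\<close>

definition crosses :: "nat \<Rightarrow> nat set \<Rightarrow> bool" where
  "crosses s u \<longleftrightarrow> (\<exists>i j. u = {i, j} \<and> i \<le> s \<and> s < j)"

lemma skew_prime_crossed:
  assumes "\<pi> \<in> skew_prime" "1 \<le> s" "s < length \<pi>"
  obtains u where "u \<in> V12 \<pi>" "crosses s u"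
proof (rule ccontr)
  assume "\<not> thesis"
  with that have no: "\<not> crosses s u" if "u \<in> V12 \<pi>" for u
    using that by blast
  have \<pi>: "\<pi> \<in> perms" using assms by (simp add: skew_prime_def)
  have "ent \<pi> j < ent \<pi> i" if ij: "1 \<le> i" "i \<le> s" "s < j" "j \<le> length \<pi>" for i j
  proof (rule ccontr)
    assume "\<not> ?thesis"
    moreover have "ent \<pi> i \<noteq> ent \<pi> j" using ent_eq_iff[OF \<pi>] ij by simp
    ultimately have "ent \<pi> i < ent \<pi> j" by simp
    then have "{i, j} \<in> V12 \<pi>" using ij by (intro V12I) auto
    then show False using no[of "{i, j}"] ij unfolding crosses_def by blast
  qed
  then obtain \<alpha> \<beta> where "\<alpha> \<in> perms" "\<beta> \<in> perms" "length \<alpha> = s" "\<pi> = \<alpha> \<ominus>\<^sub>s \<beta>"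
    using skew_sum_cut[of \<pi> s] \<pi> assms(3) by (metis less_imp_le)
  moreover from this have "\<alpha> \<noteq> []" "\<beta> \<noteq> []" using assms(2,3) by auto
  ultimately show False
    using assms(1) unfolding skew_prime_def skew_indecomposable_def by blast
qed

lemma sym_rtrancl_share: "(u, v) \<in> (share V)\<^sup>* \<Longrightarrow> (v, u) \<in> (share V)\<^sup>*"
  by (rule symD[OF sym_rtrancl]) (auto simp: sym_def share_def Int_commute)

text \<open>The conclusion uses the closure, not \<open>share\<close> itself, to include the case j
  = k, where the two pairs coincide.\<close>

lemma share_common_elem:
  assumes "{i, j} \<in> V" "{i, k} \<in> V" "j \<noteq> i" "k \<noteq> i"
  shows "({i, j}, {i, k}) \<in> (share V)\<^sup>*"
proof (cases "j = k")
  case False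
  then have "{i, j} \<inter> {i, k} = {i}" using assms by auto
  then have "card ({i, j} \<inter> {i, k}) = 1" by (simp only: card.empty card.insert) simp
  then show ?thesis using assms(1,2) unfolding share_def by blast
qed simp

lemma V12_crossesE:
  assumes "u \<in> V12 \<pi>" "crosses s u"
  obtains i j where "u = {i, j}" "1 \<le> i" "i \<le> s" "s < j" "j \<le> length \<pi>" "ent \<pi> i < ent \<pi> j"
proof -
  from assms(1) obtain i j where "u = {i, j}" "1 \<le> i" "i < j" "j \<le> length \<pi>" "ent \<pi> i < ent \<pi> j"
    by (auto simp: V12_iff)
  moreover from this assms(2) have "i \<le> s" "s < j"
    by (auto simp: crosses_def doubleton_eq_iff)
  ultimately show ?thesis using that by blast
qed

text \<open>Of the two left ends, the one with the smaller entry forms an ascent with the right end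
  of the other pair. This third occurrence shares an element with each of the two.\<close>

lemma crosses_same_reachable:
  assumes "u \<in> V12 \<pi>" "crosses s u" "v \<in> V12 \<pi>" "crosses s v"
  shows "(u, v) \<in> (share (V12 \<pi>))\<^sup>*"
proof -
  from assms(1,2) obtain i j where
    u: "u = {i, j}" "1 \<le> i" "i \<le> s" "s < j" "j \<le> length \<pi>" "ent \<pi> i < ent \<pi> j"
    by (rule V12_crossesE)
  from assms(3,4) obtain k l where
    v: "v = {k, l}" "1 \<le> k" "k \<le> s" "s < l" "l \<le> length \<pi>" "ent \<pi> k < ent \<pi> l"
    by (rule V12_crossesE)
  show ?thesis
  proof (cases "ent \<pi> i \<le> ent \<pi> k")
    case True
    then have w: "{i, l} \<in> V12 \<pi>"
      using u v by (intro V12I) auto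
    have "(u, {i, l}) \<in> (share (V12 \<pi>))\<^sup>*"
      using share_common_elem[of i j "V12 \<pi>" l] w u v assms by simp
    moreover have "({i, l}, v) \<in> (share (V12 \<pi>))\<^sup>*"
      using share_common_elem[of l i "V12 \<pi>" k] w u v assms by (simp add: insert_commute)
    ultimately show ?thesis by (rule rtrancl_trans)
  next
    case False
    then have w: "{k, j} \<in> V12 \<pi>"
      using u v by (intro V12I) auto
    have "(u, {k, j}) \<in> (share (V12 \<pi>))\<^sup>*"
      using share_common_elem[of j i "V12 \<pi>" k] w u v assms by (simp add: insert_commute)
    moreover have "({k, j}, v) \<in> (share (V12 \<pi>))\<^sup>*"
      using share_common_elem[of k j "V12 \<pi>" l] w u v assms by simp
    ultimately show ?thesis by (rule rtrancl_trans)
  qed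
qed

lemma crosses_Suc_reachable:
  assumes "u \<in> V12 \<pi>" "crosses s u" "v \<in> V12 \<pi>" "crosses (Suc s) v"
  shows "(u, v) \<in> (share (V12 \<pi>))\<^sup>*"
proof -
  from assms(1,2) obtain i j where
    u: "u = {i, j}" "1 \<le> i" "i \<le> s" "s < j" "j \<le> length \<pi>" "ent \<pi> i < ent \<pi> j"
    by (rule V12_crossesE)
  from assms(3,4) obtain k l where
    v: "v = {k, l}" "1 \<le> k" "k \<le> Suc s" "Suc s < l" "l \<le> length \<pi>" "ent \<pi> k < ent \<pi> l"
    by (rule V12_crossesE)
  \<comment> \<open>The pair u misses the gap \<open>Suc s\<close> only if it ends at position
    \<open>Suc s\<close>, and v misses the gap s only if it starts there.\<close>
  consider "Suc s < j" | "k \<le> s" | "j = Suc s" "k = Suc s" using u v by linarith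
  then show ?thesis
  proof cases
    case 1
    then have "crosses (Suc s) u" using u unfolding crosses_def by (metis le_SucI)
    then show ?thesis using crosses_same_reachable assms by blast
  next
    case 2
    then have "crosses s v" using v unfolding crosses_def by (metis Suc_lessD)
    then show ?thesis using crosses_same_reachable assms by blast
  next
    case 3
    then show ?thesis
      using share_common_elem[of j i "V12 \<pi>" l] u v assms by (simp add: insert_commute)
  qed
qed

text \<open>Occurrences crossing the same gap are joined through a third one, occurrences crossing
  neighbouring gaps either cross a common gap or share an element; indecomposability says that no
  gap is left uncrossed.\<close>

lemma skew_prime_linked:
  assumes "\<pi> \<in> skew_prime"
  shows "linked (V12 \<pi>)"
proof -
  have mono: "(u, v) \<in> (share (V12 \<pi>))\<^sup>*"
    if "s \<le> t" "u \<in> V12 \<pi>" "crosses s u" "v \<in> V12 \<pi>" "crosses t v" "1 \<le> s" for s t u v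
    using that
  proof (induction arbitrary: v rule: dec_induct)
    case base
    then show ?case using crosses_same_reachable by blast
  next
    case (step m)
    have "Suc m < length \<pi>"
      by (rule V12_crossesE[OF step.prems(3,4)]) linarith
    then obtain w where w: "w \<in> V12 \<pi>" "crosses m w"
      using skew_prime_crossed[OF assms, of m] step.hyps step.prems by auto
    then have "(u, w) \<in> (share (V12 \<pi>))\<^sup>*" using step by blast
    also have "(w, v) \<in> (share (V12 \<pi>))\<^sup>*"
      using w step.prems crosses_Suc_reachable by blast
    finally show ?case .
  qed
  \<comment> \<open>An occurrence crosses the gap directly after its left end.\<close>
  have ex: "\<exists>s\<ge>1. crosses s u" if "u \<in> V12 \<pi>" for u
  proof -
    from that obtain i j where "u = {i, j}" "1 \<le> i" "i < j" unfolding V12_iff by blast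
    then show ?thesis unfolding crosses_def by (metis order_refl)
  qed
  show ?thesis
    unfolding linked_def
  proof (intro ballI)
    fix u v assume uv: "u \<in> V12 \<pi>" "v \<in> V12 \<pi>"
    then obtain s t where "crosses s u" "crosses t v" "1 \<le> s" "1 \<le> t" using ex by blast
    then show "(u, v) \<in> (share (V12 \<pi>))\<^sup>*"
      using mono[of s t u v] mono[of t s v u] uv sym_rtrancl_share by (meson nle_le)
  qed
qed

text \<open>In a longer skew prime the gap after position 1 must be crossed, which provides an
  ascent.\<close>

lemma skew_prime_V12_empty_iff:
  assumes "\<alpha> \<in> skew_prime"
  shows "V12 \<alpha> = {} \<longleftrightarrow> \<alpha> = [1]"
proof
  assume "V12 \<alpha> = {}"
  then have "\<not> 1 < length \<alpha>" using skew_prime_crossed[OF assms, of 1] by auto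
  moreover have "\<alpha> \<noteq> []" "\<alpha> \<in> perms" using assms by (auto simp: skew_prime_def)
  ultimately show "\<alpha> = [1]" using length_1_perm by (cases \<alpha>) auto
qed simp

text \<open>This is the form of disconnectedness that the mesh pattern detects: one cut with ascents
  on both sides. If the first component has an ascent, cutting after it works, as the component
  itself is linked; otherwise the cut is found in the rest by induction.\<close>

lemma not_linked_iff_split:
  assumes "\<pi> \<in> perms"
  shows "\<not> linked (V12 \<pi>) \<longleftrightarrow>
    (\<exists>\<alpha>\<in>perms. \<exists>\<beta>\<in>perms. \<pi> = \<alpha> \<ominus>\<^sub>s \<beta> \<and> V12 \<alpha> \<noteq> {} \<and> V12 \<beta> \<noteq> {})"
proof
  assume "\<not> linked (V12 \<pi>)"
  with assms show "\<exists>\<alpha>\<in>perms. \<exists>\<beta>\<in>perms. \<pi> = \<alpha> \<ominus>\<^sub>s \<beta> \<and> V12 \<alpha> \<noteq> {} \<and> V12 \<beta> \<noteq> {}"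
  proof (induction "length \<pi>" arbitrary: \<pi> rule: less_induct)
    case less
    then have "\<pi> \<noteq> []" by auto
    then obtain \<alpha> \<beta> where *: "\<alpha> \<in> skew_prime" "\<beta> \<in> perms" "\<pi> = \<alpha> \<ominus>\<^sub>s \<beta>"
      using first_component_exists less.prems(1) by blast
    then have \<alpha>: "\<alpha> \<in> perms" "\<alpha> \<noteq> []" by (auto simp: skew_prime_def)
    show ?case
    proof (cases "V12 \<alpha> = {}")
      case True
      then have "\<not> linked (V12 \<beta>)"
        using less.prems(2) linked_skew_sum_iff[OF \<alpha>(1) *(2)] * by simp
      moreover have "length \<beta> < length \<pi>" using * \<alpha> by simp
      ultimately obtain \<gamma> \<delta> where
        "\<gamma> \<in> perms" "\<delta> \<in> perms" "\<beta> = \<gamma> \<ominus>\<^sub>s \<delta>" "V12 \<gamma> \<noteq> {}" "V12 \<delta> \<noteq> {}"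
        using less.hyps * by blast
      \<comment> \<open>The ascent-free first component is absorbed into the left factor.\<close>
      then show ?thesis
        using * \<alpha> by (intro bexI[of _ "\<alpha> \<ominus>\<^sub>s \<gamma>"] bexI[of _ \<delta>])
          (auto simp: skew_sum_assoc skew_sum_in_perms V12_skew_sum)
    next
      case False
      then show ?thesis
        using less.prems(2) linked_skew_sum_iff[OF \<alpha>(1) *(2)] * \<alpha> skew_prime_linked by blast
    qed
  qed
next
  assume "\<exists>\<alpha>\<in>perms. \<exists>\<beta>\<in>perms. \<pi> = \<alpha> \<ominus>\<^sub>s \<beta> \<and> V12 \<alpha> \<noteq> {} \<and> V12 \<beta> \<noteq> {}"
  then show "\<not> linked (V12 \<pi>)" using linked_skew_sum_iff by metis
qed


section \<open>The mesh pattern\<close>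

text \<open>The maps \<open>\<iota>\<close> and \<open>v\<close> of an occurrence will be given as
  lookups in explicit lists; their monotonicity becomes sortedness.\<close>

lemma strict_mono_on_nth:
  fixes xs :: "nat list"
  assumes "sorted_wrt (<) xs" "length xs = Suc k"
  shows "strict_mono_on {0..k} ((!) xs)"
proof (rule strict_mono_onI)
  fix r s assume "r \<in> {0..k}" "s \<in> {0..k}" "r < s"
  then show "xs ! r < xs ! s" using sorted_wrt_nth_less[OF assms(1)] assms(2) by simp
qed

lemma atLeastAtMost_1_4: "{1..4} = {1, 2, 3, 4 :: nat}"
  by auto

lemma ent_3412: "ent [3, 4, 1, 2] 1 = 3" "ent [3, 4, 1, 2] 2 = 4"
  "ent [3, 4, 1, 2] 3 = 1" "ent [3, 4, 1, 2] 4 = 2"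
  by (simp_all add: ent_def)

lemma mesh_contains_3412_iff:
  "mesh_contains \<pi> mesh_3412 \<longleftrightarrow> (\<exists>\<iota> v.
     strict_mono_on {0..5} \<iota> \<and> \<iota> 0 = 0 \<and> \<iota> 5 = length \<pi> + 1 \<and>
     (\<forall>a \<in> {1..4}. \<forall>b \<in> {1..4}. ent \<pi> (\<iota> a) < ent \<pi> (\<iota> b) \<longleftrightarrow>
        ent [3, 4, 1, 2] a < ent [3, 4, 1, 2] b) \<and>
     strict_mono_on {0..5} v \<and> v 0 = 0 \<and> v 5 = length \<pi> + 1 \<and>
     v ` {1..4} = (\<lambda>a. ent \<pi> (\<iota> a)) ` {1..4} \<and>
     (\<forall>(a, b) \<in> snd mesh_3412. \<not> (\<exists>x \<in> {1..length \<pi>}. \<iota> a < x \<and> x < \<iota> (a + 1) \<and>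
        v b < ent \<pi> x \<and> ent \<pi> x < v (b + 1))))"
proof -
  have "fst mesh_3412 = [3, 4, 1, 2]" by (simp add: mesh_3412_def)
  moreover have "length [3, 4, 1, 2 :: nat] = 4" "4 + 1 = (5 :: nat)" by simp_all
  ultimately show ?thesis
    by (simp only: mesh_contains_def Let_def case_prod_unfold)
qed

text \<open>The first and the largest entry of \<open>\<beta>\<close> are to play 1 and 2, so they
  must differ. If they coincide, that entry is a component of its own and moves over to
  \<open>\<alpha>\<close>; the ascents of \<open>\<beta>\<close> all survive in the shorter
  remainder.\<close>

lemma split_first_not_max:
  assumes "\<alpha> \<in> perms" "\<beta> \<in> perms" "V12 \<alpha> \<noteq> {}" "V12 \<beta> \<noteq> {}"
  obtains \<alpha>' \<beta>' where "\<alpha>' \<in> perms" "\<beta>' \<in> perms" "\<alpha> \<ominus>\<^sub>s \<beta> = \<alpha>' \<ominus>\<^sub>s \<beta>'"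
    "V12 \<alpha>' \<noteq> {}" "\<beta>' \<noteq> []" "ent \<beta>' 1 \<noteq> length \<beta>'"
  using assms
proof (induction "length \<beta>" arbitrary: \<alpha> \<beta> thesis rule: less_induct)
  case less
  have "\<beta> \<noteq> []" using less.prems(5) by auto
  then have len: "1 \<le> length \<beta>" by (cases \<beta>) auto
  show ?case
  proof (cases "ent \<beta> 1 = length \<beta>")
    case False
    then show ?thesis using less.prems \<open>\<beta> \<noteq> []\<close> by blast
  next
    case True
    have "ent \<beta> j < ent \<beta> i" if "1 \<le> i" "i \<le> 1" "1 < j" "j \<le> length \<beta>" for i j
    proof -
      have "i = 1" using that by simp
      moreover have "ent \<beta> j \<noteq> ent \<beta> 1" "ent \<beta> j \<le> length \<beta>"
        using ent_eq_iff[OF less.prems(3), of j 1] ent_bounds(2)[OF less.prems(3), of j] that by auto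
      ultimately show ?thesis using True by simp
    qed
    then obtain \<gamma> \<delta> where *: "\<gamma> \<in> perms" "\<delta> \<in> perms" "length \<gamma> = 1" "\<beta> = \<gamma> \<ominus>\<^sub>s \<delta>"
      using skew_sum_cut[OF less.prems(3) len] by blast
    then have "\<gamma> = [1]" using length_1_perm by blast
    then have "V12 \<delta> \<noteq> {}" using less.prems(5) * V12_skew_sum by auto
    moreover have "V12 (\<alpha> \<ominus>\<^sub>s \<gamma>) \<noteq> {}"
      using less.prems(2,4) * V12_skew_sum by auto
    moreover have "\<alpha> \<ominus>\<^sub>s \<gamma> \<in> perms" using less.prems(2) * skew_sum_in_perms by blast
    moreover have "length \<delta> < length \<beta>" using * by simp
    moreover have "\<alpha> \<ominus>\<^sub>s \<beta> = (\<alpha> \<ominus>\<^sub>s \<gamma>) \<ominus>\<^sub>s \<delta>" using * by (simp add: skew_sum_assoc)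
    ultimately show ?thesis
      using less.hyps[of \<delta> "\<alpha> \<ominus>\<^sub>s \<gamma>"] less.prems(1) *(2) by metis
  qed
qed

text \<open>An ascent of \<open>\<alpha>\<close> plays 34. The shaded boxes on the left lie below
  the value \<open>length \<beta>\<close> at positions of \<open>\<alpha>\<close>, those on the
  right above it at positions of \<open>\<beta>\<close>, so neither contains an entry.\<close>

lemma mesh_contains_skew_sum:
  assumes \<alpha>: "\<alpha> \<in> perms" and \<beta>: "\<beta> \<in> perms"
    and "V12 \<alpha> \<noteq> {}" and "\<beta> \<noteq> []" and not_max: "ent \<beta> 1 \<noteq> length \<beta>"
  shows "mesh_contains (\<alpha> \<ominus>\<^sub>s \<beta>) mesh_3412"
proof -
  define \<pi> where "\<pi> = \<alpha> \<ominus>\<^sub>s \<beta>"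
  define a b where "a = length \<alpha>" and "b = length \<beta>"
  have n: "length \<pi> = a + b" by (simp add: \<pi>_def a_def b_def)
  have left: "ent \<pi> x = ent \<alpha> x + b" if "1 \<le> x" "x \<le> a" for x
    using that ent_skew_sum_left by (simp add: \<pi>_def a_def b_def)
  have right: "ent \<pi> (a + y) = ent \<beta> y" if "1 \<le> y" for y
    using that ent_skew_sum_right by (simp add: \<pi>_def a_def b_def)
  obtain i1 i2 where i: "1 \<le> i1" "i1 < i2" "i2 \<le> a" "ent \<alpha> i1 < ent \<alpha> i2"
    using assms(3) unfolding a_def by (auto simp: V12_iff)
  have ai: "1 \<le> ent \<alpha> i1" "ent \<alpha> i2 \<le> a"
    using ent_bounds[OF \<alpha>, of i1] ent_bounds[OF \<alpha>, of i2] i by (auto simp: a_def)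
  have b: "1 \<le> b" using assms(4) by (cases \<beta>) (auto simp: b_def)
  then have b1: "1 \<le> ent \<beta> 1" "ent \<beta> 1 < b"
    using ent_bounds[OF \<beta>, of 1] not_max by (auto simp: b_def)
  have "b \<in> set \<beta>" using \<beta> b unfolding perms_iff b_def by auto
  then obtain q where q: "q < b" "\<beta> ! q = b" unfolding b_def by (metis in_set_conv_nth)
  \<comment> \<open>List indices start at 0, positions at 1.\<close>
  define p where "p = Suc q"
  have p: "ent \<beta> p = b" "p \<le> b" using q by (auto simp: p_def ent_def)
  moreover have "p \<noteq> 1" using p(1) b1 by auto
  ultimately have p1: "1 < p" by (simp add: p_def)
  have \<pi>_vals: "ent \<pi> i1 = ent \<alpha> i1 + b" "ent \<pi> i2 = ent \<alpha> i2 + b"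
    "ent \<pi> (a + 1) = ent \<beta> 1" "ent \<pi> (a + p) = b"
    using left[of i1] left[of i2] right[of 1] right[of p] i p p1 by auto
  have high: "b < ent \<pi> x" if "1 \<le> x" "x \<le> a" for x
    using left[OF that] ent_bounds(1)[OF \<alpha>, of x] that by (simp add: a_def)
  have low: "ent \<pi> x \<le> b" if "a < x" "x \<le> a + b" for x
  proof -
    have "ent \<pi> x = ent \<beta> (x - a)" using right[of "x - a"] that by simp
    then show ?thesis using ent_bounds(2)[OF \<beta>, of "x - a"] that by (simp add: b_def)
  qed
  \<comment> \<open>The outer list members are the boundary values 0 and n + 1; the second list has
    the four pattern values in increasing order.\<close>
  define \<iota> where "\<iota> = (!) [0, i1, i2, a + 1, a + p, a + b + 1]"
  define v where "v = (!) [0, ent \<beta> 1, b, ent \<alpha> i1 + b, ent \<alpha> i2 + b, a + b + 1]"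
  have \<iota>: "\<iota> 0 = 0" "\<iota> 1 = i1" "\<iota> 2 = i2" "\<iota> 3 = a + 1" "\<iota> 4 = a + p" "\<iota> 5 = a + b + 1"
    by (simp_all add: \<iota>_def)
  have v: "v 0 = 0" "v 1 = ent \<beta> 1" "v 2 = b" "v 3 = ent \<alpha> i1 + b" "v 4 = ent \<alpha> i2 + b"
    "v 5 = a + b + 1"
    by (simp_all add: v_def)
  have "strict_mono_on {0..5} \<iota>"
    unfolding \<iota>_def by (rule strict_mono_on_nth) (use i p p1 in auto)
  moreover have "strict_mono_on {0..5} v"
    unfolding v_def by (rule strict_mono_on_nth) (use i ai b b1 in auto)
  moreover have "\<forall>a\<in>{1..4}. \<forall>b\<in>{1..4}. ent \<pi> (\<iota> a) < ent \<pi> (\<iota> b) \<longleftrightarrow>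
      ent [3, 4, 1, 2] a < ent [3, 4, 1, 2] b"
    unfolding atLeastAtMost_1_4 ball_simps ent_3412 \<iota> \<pi>_vals using i ai b1 by auto
  moreover have "v ` {1..4} = (\<lambda>a. ent \<pi> (\<iota> a)) ` {1..4}"
    unfolding atLeastAtMost_1_4 image_insert image_empty \<iota> \<pi>_vals v by auto
  moreover have "\<forall>(c, d) \<in> snd mesh_3412. \<not> (\<exists>x \<in> {1..a + b}. \<iota> c < x \<and> x < \<iota> (c + 1) \<and>
      v d < ent \<pi> x \<and> ent \<pi> x < v (d + 1))"
  proof (clarify)
    fix c d x
    assume R: "(c, d) \<in> snd mesh_3412" and x: "x \<in> {1..a + b}"
      and box: "\<iota> c < x" "x < \<iota> (c + 1)" "v d < ent \<pi> x" "ent \<pi> x < v (d + 1)"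
    \<comment> \<open>The twelve shaded boxes form two rectangles.\<close>
    have "c \<in> {0, 1, 2} \<and> d \<in> {0, 1} \<or> c \<in> {3, 4} \<and> d \<in> {2, 3, 4}"
      using R by (auto simp: mesh_3412_def)
    then show False
    proof
      assume "c \<in> {0, 1, 2} \<and> d \<in> {0, 1}"
      then have "\<iota> (c + 1) \<le> a + 1" "v (d + 1) \<le> b"
        using \<iota> v i b1 by (auto simp: numeral_eq_Suc)
      then show False using high[of x] box x by auto
    next
      assume "c \<in> {3, 4} \<and> d \<in> {2, 3, 4}"
      then have "a < \<iota> c" "b \<le> v d" using \<iota> v p1 by auto
      then show False using low[of x] box x by auto
    qed
  qed
  ultimately have "mesh_contains \<pi> mesh_3412"
    unfolding mesh_contains_3412_iff n using \<iota> v by blast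
  then show ?thesis by (simp add: \<pi>_def)
qed

text \<open>The cut is made just before the entry playing 1. An entry violating the cut would fall
  into one of the two shaded rectangles; the entries playing 34 and 12 supply the ascents on either
  side.\<close>

lemma mesh_contains_imp_split:
  assumes \<pi>: "\<pi> \<in> perms" and "mesh_contains \<pi> mesh_3412"
  shows "\<exists>\<alpha>\<in>perms. \<exists>\<beta>\<in>perms. \<pi> = \<alpha> \<ominus>\<^sub>s \<beta> \<and> V12 \<alpha> \<noteq> {} \<and> V12 \<beta> \<noteq> {}"
proof -
  define n where "n = length \<pi>"
  from assms(2) obtain \<iota> v where
    \<iota>: "strict_mono_on {0..5} \<iota>" "\<iota> 0 = 0" "\<iota> 5 = n + 1" and
    v: "strict_mono_on {0..5} v" "v 0 = 0" "v 5 = n + 1" and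
    iso: "\<forall>a\<in>{1..4}. \<forall>b\<in>{1..4}. ent \<pi> (\<iota> a) < ent \<pi> (\<iota> b) \<longleftrightarrow>
      ent [3, 4, 1, 2] a < ent [3, 4, 1, 2] b" and
    img: "v ` {1..4} = (\<lambda>a. ent \<pi> (\<iota> a)) ` {1..4}" and
    box: "\<forall>(a, b) \<in> snd mesh_3412. \<not> (\<exists>x \<in> {1..n}. \<iota> a < x \<and> x < \<iota> (a + 1) \<and>
      v b < ent \<pi> x \<and> ent \<pi> x < v (b + 1))"
    unfolding mesh_contains_3412_iff n_def by blast
  have pos: "0 < \<iota> 1" "\<iota> 1 < \<iota> 2" "\<iota> 2 < \<iota> 3" "\<iota> 3 < \<iota> 4" "\<iota> 4 < n + 1"
    using strict_mono_onD[OF \<iota>(1), of 0 1] strict_mono_onD[OF \<iota>(1), of 1 2]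
      strict_mono_onD[OF \<iota>(1), of 2 3] strict_mono_onD[OF \<iota>(1), of 3 4]
      strict_mono_onD[OF \<iota>(1), of 4 5] \<iota>(2,3) by auto
  have vals: "v 1 < v 2" "v 2 < v 3" "v 3 < v 4"
    using strict_mono_onD[OF v(1), of 1 2]
      strict_mono_onD[OF v(1), of 2 3] strict_mono_onD[OF v(1), of 3 4] by auto
  have ord: "ent \<pi> (\<iota> 3) < ent \<pi> (\<iota> 4)" "ent \<pi> (\<iota> 4) < ent \<pi> (\<iota> 1)" "ent \<pi> (\<iota> 1) < ent \<pi> (\<iota> 2)"
    using iso unfolding atLeastAtMost_1_4 ball_simps ent_3412 by simp_all
  \<comment> \<open>Only the set of values of \<open>v\<close> is prescribed, but both lists are
    strictly increasing and hence equal.\<close>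
  have "[v 1, v 2, v 3, v 4] = [ent \<pi> (\<iota> 3), ent \<pi> (\<iota> 4), ent \<pi> (\<iota> 1), ent \<pi> (\<iota> 2)]"
  proof (rule sorted_distinct_set_unique)
    show "set [v 1, v 2, v 3, v 4] = set [ent \<pi> (\<iota> 3), ent \<pi> (\<iota> 4), ent \<pi> (\<iota> 1), ent \<pi> (\<iota> 2)]"
      using img unfolding atLeastAtMost_1_4 image_insert image_empty by auto
  qed (use vals ord in auto)
  then have v_eq: "v 1 = ent \<pi> (\<iota> 3)" "v 2 = ent \<pi> (\<iota> 4)" "v 3 = ent \<pi> (\<iota> 1)" "v 4 = ent \<pi> (\<iota> 2)"
    by simp_all
  have neq: "ent \<pi> x \<noteq> ent \<pi> (\<iota> c)" if "1 \<le> x" "x \<le> n" "x \<noteq> \<iota> c" "c \<in> {1, 2, 3, 4}" for x c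
  proof -
    have "1 \<le> \<iota> c" "\<iota> c \<le> n" using that(4) pos by auto
    then show ?thesis using ent_eq_iff[OF \<pi>, of x "\<iota> c"] that unfolding n_def by blast
  qed
  have before: "v 2 < ent \<pi> x" if x: "1 \<le> x" "x < \<iota> 3" for x
  proof (rule ccontr)
    assume "\<not> ?thesis"
    moreover have x_le: "x \<le> n" "x \<noteq> \<iota> 3" "x \<noteq> \<iota> 4" using x pos by auto
    ultimately have lt: "ent \<pi> x < v 2" using neq[of x 4] x v_eq by simp
    have "x \<noteq> \<iota> 1" "x \<noteq> \<iota> 2" using lt vals v_eq by auto
    \<comment> \<open>Boxes are open, so x has to differ from every pattern position before a column
      can be chosen; the same applies to its entry and the row.\<close>
    then have "\<exists>a\<in>{0, 1, 2}. \<iota> a < x \<and> x < \<iota> (a + 1)"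
      using x \<iota>(2) by (auto simp: numeral_eq_Suc)
    then obtain a where a: "a \<in> {0, 1, 2}" "\<iota> a < x" "x < \<iota> (a + 1)" by blast
    have "ent \<pi> x \<noteq> v 1" using neq[of x 3] x x_le v_eq by simp
    moreover have "0 < ent \<pi> x" using ent_bounds(1)[OF \<pi>, of x] x x_le n_def by simp
    ultimately have "\<exists>b\<in>{0, 1}. v b < ent \<pi> x \<and> ent \<pi> x < v (b + 1)"
      using lt v(2) by (auto simp: numeral_eq_Suc)
    then obtain b where b: "b \<in> {0, 1}" "v b < ent \<pi> x" "ent \<pi> x < v (b + 1)" by blast
    have "(a, b) \<in> snd mesh_3412" using a(1) b(1) by (auto simp: mesh_3412_def)
    then show False using box a b x x_le by fastforce
  qed
  have after: "ent \<pi> x \<le> v 2" if x: "\<iota> 3 < x" "x \<le> n" for x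
  proof (rule ccontr)
    assume gt: "\<not> ?thesis"
    have x1: "1 \<le> x" "x \<noteq> \<iota> 1" "x \<noteq> \<iota> 2" using x pos by auto
    have "x \<noteq> \<iota> 4" using gt v_eq by auto
    then have "\<exists>a\<in>{3, 4}. \<iota> a < x \<and> x < \<iota> (a + 1)"
      using x \<iota>(3) by (auto simp: numeral_eq_Suc)
    then obtain a where a: "a \<in> {3, 4}" "\<iota> a < x" "x < \<iota> (a + 1)" by blast
    have "ent \<pi> x \<noteq> v 3" "ent \<pi> x \<noteq> v 4"
      using neq[of x 1] neq[of x 2] x x1 v_eq by simp_all
    moreover have "ent \<pi> x < n + 1" using ent_bounds(2)[OF \<pi>, of x] x x1 n_def by simp
    ultimately have "\<exists>b\<in>{2, 3, 4}. v b < ent \<pi> x \<and> ent \<pi> x < v (b + 1)"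
      using gt v(3) by (auto simp: numeral_eq_Suc)
    then obtain b where b: "b \<in> {2, 3, 4}" "v b < ent \<pi> x" "ent \<pi> x < v (b + 1)" by blast
    have "(a, b) \<in> snd mesh_3412" using a(1) b(1) by (auto simp: mesh_3412_def)
    then show False using box a b x x1 by fastforce
  qed
  have "ent \<pi> j < ent \<pi> i" if "1 \<le> i" "i \<le> \<iota> 3 - 1" "\<iota> 3 - 1 < j" "j \<le> length \<pi>" for i j
  proof -
    have "v 2 < ent \<pi> i" using before[of i] that pos by linarith
    \<comment> \<open>The fact \<open>after\<close> starts beyond \<open>\<iota> 3\<close>; the
      position \<open>\<iota> 3\<close> itself carries the smaller value \<open>v 1\<close>.\<close>
    moreover have "ent \<pi> j \<le> v 2"
      using after[of j] that v_eq vals unfolding n_def by (cases "j = \<iota> 3") auto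
    ultimately show ?thesis by simp
  qed
  moreover have "\<iota> 3 - 1 \<le> length \<pi>" using pos by (simp add: n_def)
  ultimately obtain \<alpha> \<beta> where *: "\<alpha> \<in> perms" "\<beta> \<in> perms" "length \<alpha> = \<iota> 3 - 1" "\<pi> = \<alpha> \<ominus>\<^sub>s \<beta>"
    using skew_sum_cut[OF \<pi>] by blast
  have "ent \<pi> (\<iota> 1) = ent \<alpha> (\<iota> 1) + length \<beta>" "ent \<pi> (\<iota> 2) = ent \<alpha> (\<iota> 2) + length \<beta>"
    unfolding *(4) using *(3) pos by (auto intro!: ent_skew_sum_left)
  then have "{\<iota> 1, \<iota> 2} \<in> V12 \<alpha>" using ord pos *(3) by (intro V12I) auto
  \<comment> \<open>Since \<open>\<alpha>\<close> has length \<open>\<iota> 3 - 1\<close>, positions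
    of \<open>\<beta>\<close> are obtained by subtracting that amount.\<close>
  moreover have "ent \<pi> (\<iota> 3) = ent \<beta> 1" "ent \<pi> (\<iota> 4) = ent \<beta> (\<iota> 4 - \<iota> 3 + 1)"
    using ent_skew_sum_right[of 1 \<alpha> \<beta>] ent_skew_sum_right[of "\<iota> 4 - \<iota> 3 + 1" \<alpha> \<beta>] * pos by auto
  then have "{1, \<iota> 4 - \<iota> 3 + 1} \<in> V12 \<beta>"
    using ord pos * by (intro V12I) (auto simp: n_def)
  ultimately show ?thesis using * by blast
qed

lemma G12_conn_eq_Av: "G12_conn = Av mesh_3412"
proof -
  have "linked (V12 \<pi>) \<longleftrightarrow> \<not> mesh_contains \<pi> mesh_3412" if \<pi>: "\<pi> \<in> perms" for \<pi>
  proof -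
    have "mesh_contains \<pi> mesh_3412"
      if *: "\<alpha> \<in> perms" "\<beta> \<in> perms" "\<pi> = \<alpha> \<ominus>\<^sub>s \<beta>" "V12 \<alpha> \<noteq> {}" "V12 \<beta> \<noteq> {}" for \<alpha> \<beta>
      using split_first_not_max[OF *(1,2,4,5)] mesh_contains_skew_sum *(3) by metis
    then show ?thesis
      using not_linked_iff_split[OF \<pi>] mesh_contains_imp_split[OF \<pi>] by blast
  qed
  then show ?thesis by (auto simp: G12_conn_eq Av_def)
qed

section \<open>Generating functions\<close>

definition skew_product :: "nat list set \<Rightarrow> nat list set \<Rightarrow> nat list set" where
  "skew_product A B = (\<lambda>(\<alpha>, \<beta>). \<alpha> \<ominus>\<^sub>s \<beta>) ` (A \<times> B)"

lemma finite_perms_of_length: "finite (\<SS> n)"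
  by (simp add: perms_of_length_def)

text \<open>By uniqueness of the first component, members of length n correspond to pairs of lengths
  i and n - i, which is the Cauchy product.\<close>

lemma gen_fun_skew_product:
  assumes A: "A \<subseteq> skew_prime" and B: "B \<subseteq> perms"
  shows "gen_fun (skew_product A B) = gen_fun A * gen_fun B"
proof (rule fps_ext)
  fix n
  let ?S = "\<lambda>i. (A \<inter> \<SS> i) \<times> (B \<inter> \<SS> (n - i))"
  have Ap: "A \<subseteq> perms" using A by (auto simp: skew_prime_def)
  have "skew_product A B \<inter> \<SS> n = (\<lambda>(\<alpha>, \<beta>). \<alpha> \<ominus>\<^sub>s \<beta>) ` (\<Union>i\<in>{0..n}. ?S i)"
  proof (intro equalityI subsetI)
    fix \<pi> assume "\<pi> \<in> skew_product A B \<inter> \<SS> n"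
    then obtain \<alpha> \<beta> where *: "\<alpha> \<in> A" "\<beta> \<in> B" "\<pi> = \<alpha> \<ominus>\<^sub>s \<beta>" "length \<alpha> + length \<beta> = n"
      by (auto simp: skew_product_def perms_of_length_iff)
    then have "(\<alpha>, \<beta>) \<in> ?S (length \<alpha>)" "length \<alpha> \<in> {0..n}"
      using Ap B by (auto simp: perms_of_length_iff)
    then have "(\<alpha>, \<beta>) \<in> (\<Union>i\<in>{0..n}. ?S i)" by blast
    then show "\<pi> \<in> (\<lambda>(\<alpha>, \<beta>). \<alpha> \<ominus>\<^sub>s \<beta>) ` (\<Union>i\<in>{0..n}. ?S i)"
      by (rule rev_image_eqI) (simp add: *)
  next
    fix \<pi> assume "\<pi> \<in> (\<lambda>(\<alpha>, \<beta>). \<alpha> \<ominus>\<^sub>s \<beta>) ` (\<Union>i\<in>{0..n}. ?S i)"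
    then show "\<pi> \<in> skew_product A B \<inter> \<SS> n"
      using skew_sum_in_perms by (auto simp: skew_product_def perms_of_length_iff)
  qed
  moreover have "inj_on (\<lambda>(\<alpha>, \<beta>). \<alpha> \<ominus>\<^sub>s \<beta>) (\<Union>i\<in>{0..n}. ?S i)"
    by (rule inj_on_subset[OF inj_on_skew_sum]) (use A B in auto)
  ultimately have "card (skew_product A B \<inter> \<SS> n) = card (\<Union>i\<in>{0..n}. ?S i)"
    by (simp add: card_image)
  also have "\<dots> = (\<Sum>i=0..n. card (?S i))"
    by (rule card_UN_disjoint) (auto simp: finite_perms_of_length perms_of_length_iff)
  finally show "fps_nth (gen_fun (skew_product A B)) n = fps_nth (gen_fun A * gen_fun B) n"
    by (simp add: gen_fun_def fps_mult_nth card_cartesian_product)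
qed

lemma gen_fun_Un:
  assumes "A \<inter> B = {}"
  shows "gen_fun (A \<union> B) = gen_fun A + gen_fun B"
proof (rule fps_ext)
  fix n
  have "card ((A \<union> B) \<inter> \<SS> n) = card (A \<inter> \<SS> n) + card (B \<inter> \<SS> n)"
    unfolding Int_Un_distrib2
    by (rule card_Un_disjoint) (use assms in \<open>auto simp: finite_perms_of_length\<close>)
  then show "fps_nth (gen_fun (A \<union> B)) n = fps_nth (gen_fun A + gen_fun B) n"
    by (simp add: gen_fun_def)
qed

lemma gen_fun_single:
  assumes "\<pi> \<in> perms"
  shows "gen_fun {\<pi>} = fps_X ^ length \<pi>"
proof (rule fps_ext)
  fix n
  have "{\<pi>} \<inter> \<SS> n = (if n = length \<pi> then {\<pi>} else {})"
    using assms by (auto simp: perms_of_length_iff)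
  then show "fps_nth (gen_fun {\<pi>}) n = fps_nth (fps_X ^ length \<pi>) n"
    by (simp add: gen_fun_def fps_X_power_nth)
qed

lemma gen_fun_perms: "gen_fun perms = Abs_fps (\<lambda>k. fact k)"
proof (rule fps_ext)
  fix n
  have "perms \<inter> \<SS> n = \<SS> n" by (auto simp: perms_def)
  then show "fps_nth (gen_fun perms) n = fps_nth (Abs_fps (\<lambda>k. fact k)) n"
    by (simp add: gen_fun_def perms_of_length_def)
qed

lemma Nil_notin_skew_product: "A \<subseteq> skew_prime \<Longrightarrow> [] \<notin> skew_product A B"
  by (auto simp: skew_product_def skew_prime_def eq_commute[of "[]"])

text \<open>Equal skew sums would have equal first components, but \<open>A\<close> and
  \<open>A'\<close> have none in common.\<close>

lemma skew_product_disjoint: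
  assumes "A \<subseteq> skew_prime" "A' \<subseteq> skew_prime" "B \<subseteq> perms" "B' \<subseteq> perms" "A \<inter> A' = {}"
  shows "skew_product A B \<inter> skew_product A' B' = {}"
  unfolding skew_product_def
  by (subst inj_on_image_Int[OF inj_on_skew_sum, symmetric]) (use assms in auto)

section \<open>Decompositions by the first skew component\<close>

lemma perms_decomp: "perms = {[]} \<union> skew_product skew_prime perms"
proof (intro equalityI subsetI)
  fix \<pi> assume "\<pi> \<in> perms"
  then show "\<pi> \<in> {[]} \<union> skew_product skew_prime perms"
    using first_component_exists[of \<pi>] by (cases "\<pi> = []") (auto simp: skew_product_def)
qed (auto simp: skew_product_def skew_prime_def skew_sum_in_perms)

definition decreasing_perms :: "nat list set" where
  "decreasing_perms = {\<pi> \<in> perms. V12 \<pi> = {}}"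

lemma decreasing_perms_decomp:
  "decreasing_perms = {[]} \<union> skew_product {[1]} decreasing_perms"
proof (intro equalityI subsetI)
  fix \<pi> assume \<pi>: "\<pi> \<in> decreasing_perms"
  show "\<pi> \<in> {[]} \<union> skew_product {[1]} decreasing_perms"
  proof (cases "\<pi> = []")
    case False
    then obtain \<alpha> \<beta> where *: "\<alpha> \<in> skew_prime" "\<beta> \<in> perms" "\<pi> = \<alpha> \<ominus>\<^sub>s \<beta>"
      using first_component_exists[of \<pi>] \<pi> by (auto simp: decreasing_perms_def)
    moreover have "\<alpha> \<in> perms" using * by (simp add: skew_prime_def)
    ultimately have "V12 \<alpha> = {}" "V12 \<beta> = {}"
      using \<pi> V12_skew_sum by (auto simp: decreasing_perms_def)
    then show ?thesis
      using * skew_prime_V12_empty_iff[OF *(1)] by (auto simp: skew_product_def decreasing_perms_def)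
  qed simp
next
  fix \<pi> assume "\<pi> \<in> {[]} \<union> skew_product {[1]} decreasing_perms"
  then show "\<pi> \<in> decreasing_perms"
    by (auto simp: skew_product_def decreasing_perms_def skew_sum_in_perms V12_skew_sum)
qed

text \<open>A first component [1] has no ascent, so the rest alone decides. Any other first
  component is linked and has an ascent, so the rest must have none.\<close>

lemma G12_conn_decomp:
  "G12_conn = {[]} \<union> (skew_product {[1]} G12_conn \<union> skew_product (skew_prime - {[1]}) decreasing_perms)"
proof -
  have iff: "\<alpha> \<ominus>\<^sub>s \<beta> \<in> G12_conn \<longleftrightarrow>
      \<alpha> = [1] \<and> \<beta> \<in> G12_conn \<or> \<alpha> \<noteq> [1] \<and> \<beta> \<in> decreasing_perms"
    if "\<alpha> \<in> skew_prime" "\<beta> \<in> perms" for \<alpha> \<beta>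
  proof -
    have "\<alpha> \<in> perms" using that by (simp add: skew_prime_def)
    then show ?thesis
      using that skew_prime_linked[OF that(1)] skew_prime_V12_empty_iff[OF that(1)]
      by (auto simp: G12_conn_eq decreasing_perms_def linked_skew_sum_iff skew_sum_in_perms)
  qed
  show ?thesis
  proof (intro equalityI subsetI)
    fix \<pi> assume \<pi>: "\<pi> \<in> G12_conn"
    show "\<pi> \<in> {[]} \<union> (skew_product {[1]} G12_conn \<union> skew_product (skew_prime - {[1]}) decreasing_perms)"
    proof (cases "\<pi> = []")
      case False
      then obtain \<alpha> \<beta> where *: "\<alpha> \<in> skew_prime" "\<beta> \<in> perms" "\<pi> = \<alpha> \<ominus>\<^sub>s \<beta>"
        using first_component_exists[of \<pi>] \<pi> by (auto simp: G12_conn_eq)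
      then show ?thesis using iff[OF *(1,2)] \<pi> by (auto simp: skew_product_def)
    qed simp
  next
    fix \<pi>
    assume "\<pi> \<in> {[]} \<union> (skew_product {[1]} G12_conn \<union> skew_product (skew_prime - {[1]}) decreasing_perms)"
    then consider "\<pi> = []"
      | \<beta> where "\<beta> \<in> G12_conn" "\<pi> = [1] \<ominus>\<^sub>s \<beta>"
      | \<alpha> \<beta> where "\<alpha> \<in> skew_prime" "\<alpha> \<noteq> [1]" "\<beta> \<in> decreasing_perms" "\<pi> = \<alpha> \<ominus>\<^sub>s \<beta>"
      by (auto simp: skew_product_def)
    then show "\<pi> \<in> G12_conn"
    proof cases
      case 1
      then show ?thesis by (simp add: G12_conn_eq)
    next
      case 2
      then show ?thesis using iff[of "[1]" \<beta>] by (simp add: G12_conn_eq)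
    next
      case 3
      then show ?thesis using iff[of \<alpha> \<beta>] by (simp add: decreasing_perms_def)
    qed
  qed
qed

section \<open>Solving for the generating functions\<close>

lemma gen_fun_Nil_Un:
  assumes "[] \<notin> A"
  shows "gen_fun ({[]} \<union> A) = 1 + gen_fun A"
  using assms gen_fun_Un[of "{[]}" A] gen_fun_single[of "[]"] by simp

lemma gen_fun_skew_prime: "gen_fun skew_prime = 1 - 1 / Abs_fps (\<lambda>k. fact k)"
proof -
  let ?P = "Abs_fps (\<lambda>k. fact k) :: rat fps"
  have "?P = 1 + gen_fun skew_prime * ?P"
    using arg_cong[OF perms_decomp, of gen_fun] gen_fun_Nil_Un[OF Nil_notin_skew_product]
    by (simp add: gen_fun_skew_product gen_fun_perms)
  then have "(1 - gen_fun skew_prime) * ?P = 1"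
    by (simp add: algebra_simps)
  then have "1 - gen_fun skew_prime = 1 / ?P"
    by (metis mult_zero_right nonzero_mult_div_cancel_right zero_neq_one)
  then show ?thesis by (simp add: algebra_simps)
qed

lemma gen_fun_decreasing_perms: "(1 - fps_X) * gen_fun decreasing_perms = 1"
proof -
  have "decreasing_perms \<subseteq> perms" by (auto simp: decreasing_perms_def)
  then have "gen_fun decreasing_perms = 1 + fps_X * gen_fun decreasing_perms"
    using arg_cong[OF decreasing_perms_decomp, of gen_fun]
      gen_fun_Nil_Un[OF Nil_notin_skew_product, of "{[1]}" decreasing_perms]
    by (simp add: gen_fun_skew_product gen_fun_single)
  then show ?thesis by (simp add: algebra_simps)
qed

lemma gen_fun_G12_conn:
  "(1 - fps_X) * gen_fun G12_conn = 1 + (gen_fun skew_prime - fps_X) * gen_fun decreasing_perms"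
proof -
  have sub: "decreasing_perms \<subseteq> perms" "G12_conn \<subseteq> perms"
    by (auto simp: decreasing_perms_def G12_conn_def)
  have "{[1]} \<union> (skew_prime - {[1]}) = skew_prime" by auto
  then have prime: "gen_fun (skew_prime - {[1]}) = gen_fun skew_prime - fps_X"
    using gen_fun_Un[of "{[1]}" "skew_prime - {[1]}"] gen_fun_single[of "[1]"] by simp
  have disj: "skew_product {[1]} G12_conn \<inter> skew_product (skew_prime - {[1]}) decreasing_perms = {}"
    by (rule skew_product_disjoint) (use sub in auto)
  have "gen_fun G12_conn = 1 + gen_fun (skew_product {[1]} G12_conn \<union>
      skew_product (skew_prime - {[1]}) decreasing_perms)"
    \<comment> \<open>Only the occurrence on the left is unfolded, as the set reappears within its
      own decomposition.\<close>
    by (subst G12_conn_decomp, rule gen_fun_Nil_Un) (simp add: Nil_notin_skew_product)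
  also have "\<dots> = 1 + (fps_X * gen_fun G12_conn +
      (gen_fun skew_prime - fps_X) * gen_fun decreasing_perms)"
    unfolding gen_fun_Un[OF disj] using sub
    by (simp add: gen_fun_skew_product gen_fun_single flip: prime)
  finally show ?thesis by (simp add: algebra_simps)
qed

theorem theorem6p1:
  fixes F :: "rat fps"
  assumes "F = 1 - 1 / Abs_fps (\<lambda>k. fact k)"
  shows "G12_conn = Av mesh_3412 \<and>
    gen_fun G12_conn = (F - fps_X) / (1 - fps_X)\<^sup>2 + 1 / (1 - fps_X) \<and>
    F = gen_fun {\<pi> \<in> perms. \<pi> \<noteq> [] \<and> skew_indecomposable \<pi>}"
proof -
  have F: "F = gen_fun skew_prime"
    using assms gen_fun_skew_prime by simp
  let ?u = "1 - fps_X :: rat fps" and ?D = "gen_fun decreasing_perms"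
  have u: "?u * ?D = 1" by (rule gen_fun_decreasing_perms)
  then have "?u \<noteq> 0" by auto
  \<comment> \<open>Power series do not form a field, so quotients are evaluated by cancelling
    nonzero factors: dividing by \<open>?u\<close> amounts to multiplying by its inverse
    \<open>?D\<close>.\<close>
  then have D: "1 / ?u = ?D"
    by (metis u nonzero_mult_div_cancel_left)
  have "?u * ?u * (?D * ?D) = 1" using u by (metis mult.assoc mult.commute mult_1)
  then have "(F - fps_X) = (?u * ?u) * ((F - fps_X) * (?D * ?D))"
    by (metis mult.assoc mult.commute mult_1)
  then have D2: "(F - fps_X) / ?u\<^sup>2 = (F - fps_X) * (?D * ?D)"
    by (metis \<open>?u \<noteq> 0\<close> mult_eq_0_iff nonzero_mult_div_cancel_left power2_eq_square)
  have "gen_fun G12_conn = ?D * (?u * gen_fun G12_conn)"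
    using u by (metis mult.assoc mult.commute mult_1)
  also have "\<dots> = (F - fps_X) / ?u\<^sup>2 + 1 / ?u"
    unfolding gen_fun_G12_conn[folded F] D D2 by (simp add: algebra_simps)
  finally show ?thesis
    using G12_conn_eq_Av F by (simp add: skew_prime_def)
qed

end
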